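(* Let $k$ be an algebraically closed field with $\operatorname{char}(k)\neq 2$, let $n\ge 1$, and assume that the subsets $\mathrm{Salg}^i_n$ ($1\le i\le n$) are closed in $\mathrm{Salg}_n$. Then the following sets are closed in $\mathrm{Salg}_n$: (a) $\{A\in\mathrm{Salg}_n : A_1^2=\{0\}\}$; (b) $\{A\in\mathrm{Salg}_n : A_0\text{ is commutative}\}$.
   Context: A superalgebra is a $\mathbb{Z}_2$-graded associative unital algebra $A=A_0\oplus A_1$ over $k$; equivalently an algebra $A$ with an algebra automorphism $\sigma$ satisfying $\sigma^2=\mathrm{id}$ ($\sigma=1$ on $A_0$, $\sigma=-1$ on $A_1$). $\mathrm{Salg}_n\subseteq\mathbb{A}^{n^3+n^2}$ is the set of all $(\alpha^h_{ij},\gamma^j_i)_{1\le i,j,h\le n}$ such that $e_ie_j=\sum_h\alpha^h_{ij}e_h$ defines an associative algebra structure on $k^n$ (standard basis $e_1,\dots,e_n$) with identity $e_1$, and $\sigma(e_i)=\sum_j\gamma^j_ie_j$ defines an algebra automorphism with $\sigma^2=\mathrm{id}$. It is Zariski closed and carries the Zariski topology; points are identified with the superalgebras $A$ they define. $\mathrm{Salg}^i_n$ is the subset of superalgebras with $\dim A_0=i$. $A_1^2=\{0\}$ means $vw=0$ for all $v,w\in A_1$. *)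

theory Defs
  imports
    "HOL-Analysis.Abstract_Topology"
    "HOL-Computational_Algebra.Polynomial"
    "HOL-Library.Poly_Mapping"
    "HOL-Library.Function_Algebras"
begin

section \<open>The Zariski topology on affine space\<close>

text \<open>
  For an index set I, affine space is the set of functions I \<rightarrow> k, represented as the set
  \<^term>\<open>extensional I\<close> of functions that are \<^term>\<open>undefined\<close> outside I.
  A polynomial with variables indexed by \<^typ>\<open>'i\<close> is a finitely supported map from
  monomials \<^typ>\<open>'i \<Rightarrow>\<^sub>0 nat\<close> to coefficients.
\<close>

type_synonym ('i, 'k) mpoly = "('i \<Rightarrow>\<^sub>0 nat) \<Rightarrow>\<^sub>0 'k"

definition monom_eval :: "('i \<Rightarrow> 'k::comm_semiring_1) \<Rightarrow> ('i \<Rightarrow>\<^sub>0 nat) \<Rightarrow> 'k" where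
  "monom_eval x m = (\<Prod>i\<in>Poly_Mapping.keys m. x i ^ Poly_Mapping.lookup m i)"

definition mpoly_eval :: "('i \<Rightarrow> 'k::comm_semiring_1) \<Rightarrow> ('i, 'k) mpoly \<Rightarrow> 'k" where
  "mpoly_eval x p =
     (\<Sum>m\<in>Poly_Mapping.keys p. Poly_Mapping.lookup p m * monom_eval x m)"

definition mpolys_in :: "'i set \<Rightarrow> ('i, 'k::comm_semiring_1) mpoly set" where
  "mpolys_in I = {p. \<forall>m\<in>Poly_Mapping.keys p. Poly_Mapping.keys m \<subseteq> I}"

definition zero_locus :: "'i set \<Rightarrow> ('i, 'k::comm_semiring_1) mpoly set \<Rightarrow> ('i \<Rightarrow> 'k) set" where
  "zero_locus I P = {x \<in> extensional I. \<forall>p\<in>P. mpoly_eval x p = 0}"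

definition algebraic_set :: "'i set \<Rightarrow> ('i \<Rightarrow> 'k::comm_semiring_1) set \<Rightarrow> bool" where
  "algebraic_set I Z \<longleftrightarrow> (\<exists>P. P \<subseteq> mpolys_in I \<and> Z = zero_locus I P)"

definition zariski_topology :: "'i set \<Rightarrow> ('i \<Rightarrow> 'k::field) topology" where
  "zariski_topology I =
     topology (\<lambda>U. U \<subseteq> extensional I \<and> algebraic_set I (extensional I - U))"

lemma monom_eval_superset:
  assumes "finite S" "Poly_Mapping.keys m \<subseteq> S"
  shows "monom_eval x m = (\<Prod>i\<in>S. x i ^ Poly_Mapping.lookup m i)"
  unfolding monom_eval_def
  by (rule prod.mono_neutral_left) (use assms in \<open>auto simp: in_keys_iff\<close>)

lemma monom_eval_add: "monom_eval x (m + m') = monom_eval x m * monom_eval x m'"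
proof -
  let ?S = "Poly_Mapping.keys m \<union> Poly_Mapping.keys m'"
  have "monom_eval x (m + m') = (\<Prod>i\<in>?S. x i ^ Poly_Mapping.lookup (m + m') i)"
    by (rule monom_eval_superset) (auto intro: keys_add[THEN subsetD, THEN UnE])
  also have "\<dots> = (\<Prod>i\<in>?S. x i ^ Poly_Mapping.lookup m i) *
      (\<Prod>i\<in>?S. x i ^ Poly_Mapping.lookup m' i)"
    by (simp add: lookup_add power_add prod.distrib)
  also have "\<dots> = monom_eval x m * monom_eval x m'"
    by (simp add: monom_eval_superset[of ?S])
  finally show ?thesis .
qed

lemma mpoly_eval_single [simp]:
  "mpoly_eval x (Poly_Mapping.single m c) = c * monom_eval x m"
  by (simp add: mpoly_eval_def)

lemma mpoly_eval_zero [simp]: "mpoly_eval x 0 = 0"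
  by (simp add: mpoly_eval_def)

lemma mpoly_eval_one [simp]: "mpoly_eval x 1 = 1"
  by (simp add: mpoly_eval_def monom_eval_def)

lemma mpoly_eval_add: "mpoly_eval x (p + q) = mpoly_eval x p + mpoly_eval x q"
  unfolding mpoly_eval_def
  by (rule setsum_keys_plus_distrib) (simp_all add: algebra_simps)

lemma mpoly_eval_sum: "mpoly_eval x (sum f A) = (\<Sum>a\<in>A. mpoly_eval x (f a))"
  by (induction A rule: infinite_finite_induct) (simp_all add: mpoly_eval_add)

lemma mpoly_expand:
  "(\<Sum>m\<in>Poly_Mapping.keys p. Poly_Mapping.single m (Poly_Mapping.lookup p m)) = p"
  by (rule poly_mapping_eqI)
    (simp add: lookup_sum lookup_single when_def sum.delta in_keys_iff)

lemma mpoly_eval_mult: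
  fixes p q :: "('i, 'k::comm_semiring_1) mpoly"
  shows "mpoly_eval x (p * q) = mpoly_eval x p * mpoly_eval x q"
proof -
  let ?t = "\<lambda>(p :: ('i, 'k) mpoly) m. Poly_Mapping.single m (Poly_Mapping.lookup p m)"
  have "p * q = (\<Sum>m\<in>Poly_Mapping.keys p. ?t p m) * (\<Sum>m\<in>Poly_Mapping.keys q. ?t q m)"
    by (simp only: mpoly_expand)
  also have "mpoly_eval x \<dots> = mpoly_eval x p * mpoly_eval x q"
    by (simp add: sum_product mpoly_eval_sum mult_single monom_eval_add)
      (simp add: mpoly_eval_def sum_product mult_ac)
  finally show ?thesis .
qed

lemma one_in_mpolys_in: "1 \<in> mpolys_in I"
  by (simp add: mpolys_in_def)

lemma mult_in_mpolys_in:
  assumes "p \<in> mpolys_in I" "q \<in> mpolys_in I"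
  shows "p * q \<in> mpolys_in I"
proof -
  have "Poly_Mapping.keys m \<subseteq> I" if m: "m \<in> Poly_Mapping.keys (p * q)" for m
  proof -
    obtain a b where "m = a + b" "a \<in> Poly_Mapping.keys p" "b \<in> Poly_Mapping.keys q"
      using keys_mult[of p q] m by blast
    then show ?thesis
      using assms keys_add[of a b] unfolding mpolys_in_def by blast
  qed
  then show ?thesis
    by (simp add: mpolys_in_def)
qed

lemma algebraic_set_Un:
  fixes Y Z :: "('i \<Rightarrow> 'k::field) set"
  assumes "algebraic_set I Y" "algebraic_set I Z"
  shows "algebraic_set I (Y \<union> Z)"
proof -
  obtain P Q where P: "P \<subseteq> mpolys_in I" "Y = zero_locus I P"
    and Q: "Q \<subseteq> mpolys_in I" "Z = zero_locus I Q"
    using assms unfolding algebraic_set_def by blast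
  let ?R = "{p * q | p q. p \<in> P \<and> q \<in> Q}"
  have "?R \<subseteq> mpolys_in I"
    using P Q mult_in_mpolys_in by blast
  moreover have "Y \<union> Z = zero_locus I ?R"
  proof (rule set_eqI)
    fix x
    show "x \<in> Y \<union> Z \<longleftrightarrow> x \<in> zero_locus I ?R"
      unfolding P Q zero_locus_def by (auto simp: mpoly_eval_mult) (metis mpoly_eval_mult mult_eq_0_iff)
  qed
  ultimately show ?thesis
    unfolding algebraic_set_def by blast
qed

lemma algebraic_set_Inter:
  assumes "\<And>Z. Z \<in> \<Z> \<Longrightarrow> algebraic_set I Z"
  shows "algebraic_set I {x \<in> extensional I. \<forall>Z\<in>\<Z>. x \<in> Z}"
proof -
  obtain P where P: "\<And>Z. Z \<in> \<Z> \<Longrightarrow> P Z \<subseteq> mpolys_in I \<and> Z = zero_locus I (P Z)"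
    using assms unfolding algebraic_set_def by metis
  have "{x \<in> extensional I. \<forall>Z\<in>\<Z>. x \<in> Z} = zero_locus I (\<Union>Z\<in>\<Z>. P Z)"
    using P unfolding zero_locus_def by blast
  moreover have "(\<Union>Z\<in>\<Z>. P Z) \<subseteq> mpolys_in I"
    using P by blast
  ultimately show ?thesis
    unfolding algebraic_set_def by blast
qed

lemma istopology_zariski:
  "istopology (\<lambda>U :: ('i \<Rightarrow> 'k::field) set.
     U \<subseteq> extensional I \<and> algebraic_set I (extensional I - U))"
  unfolding istopology_def
proof (intro conjI allI impI)
  fix S T :: "('i \<Rightarrow> 'k) set"
  assume S: "S \<subseteq> extensional I \<and> algebraic_set I (extensional I - S)"
    and T: "T \<subseteq> extensional I \<and> algebraic_set I (extensional I - T)"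
  then show "S \<inter> T \<subseteq> extensional I"
    by blast
  have "extensional I - S \<inter> T = (extensional I - S) \<union> (extensional I - T)"
    by blast
  then show "algebraic_set I (extensional I - S \<inter> T)"
    using S T algebraic_set_Un by metis
next
  fix \<K> :: "('i \<Rightarrow> 'k) set set"
  assume K: "\<forall>U\<in>\<K>. U \<subseteq> extensional I \<and> algebraic_set I (extensional I - U)"
  then show "\<Union>\<K> \<subseteq> extensional I"
    by blast
  have "algebraic_set I {x \<in> extensional I. \<forall>Z\<in>(\<lambda>U. extensional I - U) ` \<K>. x \<in> Z}"
    by (rule algebraic_set_Inter) (use K in blast)
  moreover have "{x \<in> extensional I. \<forall>Z\<in>(\<lambda>U. extensional I - U) ` \<K>. x \<in> Z}
      = extensional I - \<Union>\<K>"
    by blast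
  ultimately show "algebraic_set I (extensional I - \<Union>\<K>)"
    by simp
qed

lemma openin_zariski:
  "openin (zariski_topology I) U \<longleftrightarrow>
     U \<subseteq> extensional I \<and> algebraic_set I (extensional I - U)"
  unfolding zariski_topology_def by (simp add: topology_inverse'[OF istopology_zariski])

lemma topspace_zariski [simp]:
  "topspace (zariski_topology I :: ('i \<Rightarrow> 'k::field) topology) = extensional I"
proof -
  have "zero_locus I {1 :: ('i, 'k) mpoly} = {}"
    by (simp add: zero_locus_def)
  then have "algebraic_set I ({} :: ('i \<Rightarrow> 'k) set)"
    unfolding algebraic_set_def using one_in_mpolys_in by (metis empty_subsetI insert_subset)
  then have "openin (zariski_topology I) (extensional I :: ('i \<Rightarrow> 'k) set)"
    by (simp add: openin_zariski)
  then show ?thesis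
    by (meson openin_zariski openin_subset openin_topspace subset_antisym)
qed

lemma closedin_zariski: "closedin (zariski_topology I) Z \<longleftrightarrow> algebraic_set I Z"
proof -
  have "Z \<subseteq> extensional I" if "algebraic_set I Z"
    using that unfolding algebraic_set_def zero_locus_def by blast
  then show ?thesis
    by (auto simp: closedin_def openin_zariski double_diff)
qed

section \<open>Superalgebra structures on a coordinate space\<close>

text \<open>
  \<open>Alpha i j h\<close> is the coordinate \<open>\<alpha>\<close> with lower indices i, j and upper index h;
  \<open>Gamma i j\<close> is the coordinate \<open>\<gamma>\<close> with lower index i and upper index j.
\<close>

datatype coord = Alpha nat nat nat | Gamma nat nat

definition coords :: "nat \<Rightarrow> coord set" where
  "coords n = {Alpha i j h | i j h. i \<in> {1..n} \<and> j \<in> {1..n} \<and> h \<in> {1..n}}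
            \<union> {Gamma i j | i j. i \<in> {1..n} \<and> j \<in> {1..n}}"

text \<open>
  The space of n-tuples over k, with indices 1 to n, consists of the functions vanishing at all
  other indices; vectors are added, subtracted and negated by the pointwise operations on functions.
\<close>

definition kspace :: "nat \<Rightarrow> (nat \<Rightarrow> 'k::field) set" where
  "kspace n = {v. \<forall>i. i \<notin> {1..n} \<longrightarrow> v i = 0}"

definition basis_vec :: "nat \<Rightarrow> nat \<Rightarrow> 'k::field" where
  "basis_vec i = (\<lambda>j. if j = i then 1 else 0)"

definition kscale :: "'k::field \<Rightarrow> (nat \<Rightarrow> 'k) \<Rightarrow> nat \<Rightarrow> 'k" where
  "kscale c v = (\<lambda>i. c * v i)"

lemma vector_space_kscale: "vector_space kscale"
  by unfold_locales (simp_all add: kscale_def fun_eq_iff algebra_simps)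

definition alg_mult ::
  "nat \<Rightarrow> (coord \<Rightarrow> 'k::field) \<Rightarrow> (nat \<Rightarrow> 'k) \<Rightarrow> (nat \<Rightarrow> 'k) \<Rightarrow> nat \<Rightarrow> 'k" where
  "alg_mult n x v w =
     (\<Sum>i\<in>{1..n}. \<Sum>j\<in>{1..n}. \<Sum>h\<in>{1..n}. kscale (v i * w j * x (Alpha i j h)) (basis_vec h))"

definition alg_sigma ::
  "nat \<Rightarrow> (coord \<Rightarrow> 'k::field) \<Rightarrow> (nat \<Rightarrow> 'k) \<Rightarrow> nat \<Rightarrow> 'k" where
  "alg_sigma n x v = (\<Sum>i\<in>{1..n}. \<Sum>j\<in>{1..n}. kscale (v i * x (Gamma i j)) (basis_vec j))"

lemma basis_vec_apply: "basis_vec i j = (if j = i then 1 else 0)"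
  by (simp add: basis_vec_def)

lemma kscale_0 [simp]: "kscale 0 v = 0"
  by (simp add: kscale_def fun_eq_iff)

lemma alg_mult_basis_vec:
  assumes "i \<in> {1..n}" "j \<in> {1..n}"
  shows "alg_mult n x (basis_vec i) (basis_vec j) =
    (\<Sum>h\<in>{1..n}. kscale (x (Alpha i j h)) (basis_vec h))"
proof -
  let ?s = "\<Sum>h\<in>{1..n}. kscale (x (Alpha i j h)) (basis_vec h)"
  have "(\<Sum>h\<in>{1..n}. kscale (basis_vec i i' * basis_vec j j' * x (Alpha i' j' h)) (basis_vec h))
      = (if j' = j then if i' = i then ?s else 0 else 0)" for i' j'
    by (simp add: basis_vec_apply)
  then have "alg_mult n x (basis_vec i) (basis_vec j) =
    (\<Sum>i'\<in>{1..n}. \<Sum>j'\<in>{1..n}. if j' = j then if i' = i then ?s else 0 else 0)"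
    unfolding alg_mult_def by (simp only:)
  then show ?thesis
    using assms by simp
qed

lemma alg_sigma_basis_vec:
  assumes "i \<in> {1..n}"
  shows "alg_sigma n x (basis_vec i) = (\<Sum>j\<in>{1..n}. kscale (x (Gamma i j)) (basis_vec j))"
proof -
  have "alg_sigma n x (basis_vec i) =
    (\<Sum>i'\<in>{1..n}. if i' = i then \<Sum>j\<in>{1..n}. kscale (x (Gamma i j)) (basis_vec j) else 0)"
    unfolding alg_sigma_def by (intro sum.cong refl) (simp add: basis_vec_apply)
  then show ?thesis
    using assms by simp
qed

text \<open>
  Bilinearity of \<^const>\<open>alg_mult\<close> and linearity of \<^const>\<open>alg_sigma\<close> hold by construction, so
  only the remaining axioms of an associative unital algebra and of an algebra automorphism appear.
\<close>

definition unital_assoc_structure :: "nat \<Rightarrow> (coord \<Rightarrow> 'k::field) \<Rightarrow> bool" where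
  "unital_assoc_structure n x \<longleftrightarrow>
     (\<forall>u\<in>kspace n. \<forall>v\<in>kspace n. \<forall>w\<in>kspace n.
        alg_mult n x (alg_mult n x u v) w = alg_mult n x u (alg_mult n x v w)) \<and>
     (\<forall>v\<in>kspace n. alg_mult n x (basis_vec 1) v = v \<and> alg_mult n x v (basis_vec 1) = v)"

definition sigma_automorphism :: "nat \<Rightarrow> (coord \<Rightarrow> 'k::field) \<Rightarrow> bool" where
  "sigma_automorphism n x \<longleftrightarrow>
     bij_betw (alg_sigma n x) (kspace n) (kspace n) \<and>
     alg_sigma n x (basis_vec 1) = basis_vec 1 \<and>
     (\<forall>v\<in>kspace n. \<forall>w\<in>kspace n.
        alg_sigma n x (alg_mult n x v w) = alg_mult n x (alg_sigma n x v) (alg_sigma n x w))"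

definition Salg :: "nat \<Rightarrow> (coord \<Rightarrow> 'k::field) set" where
  "Salg n = {x \<in> extensional (coords n).
     unital_assoc_structure n x \<and> sigma_automorphism n x \<and>
     (\<forall>v\<in>kspace n. alg_sigma n x (alg_sigma n x v) = v)}"

definition Salg_topology :: "nat \<Rightarrow> (coord \<Rightarrow> 'k::field) topology" where
  "Salg_topology n = subtopology (zariski_topology (coords n)) (Salg n)"

definition even_part :: "nat \<Rightarrow> (coord \<Rightarrow> 'k::field) \<Rightarrow> (nat \<Rightarrow> 'k) set" where
  "even_part n x = {v \<in> kspace n. alg_sigma n x v = v}"

definition odd_part :: "nat \<Rightarrow> (coord \<Rightarrow> 'k::field) \<Rightarrow> (nat \<Rightarrow> 'k) set" where
  "odd_part n x = {v \<in> kspace n. alg_sigma n x v = - v}"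

definition Salg_dim :: "nat \<Rightarrow> nat \<Rightarrow> (coord \<Rightarrow> 'k::field) set" where
  "Salg_dim n i = {x \<in> Salg n. vector_space.dim kscale (even_part n x) = i}"

end

theory Submission
  imports Defs
begin

text \<open>
  Since \<open>2\<close> is invertible and \<open>\<sigma>\<^sup>2 = id\<close>, the even and odd parts are the images of
  \<open>u \<mapsto> u + \<sigma> u\<close> and \<open>u \<mapsto> u - \<sigma> u\<close>. Hence \<open>A\<^sub>1\<^sup>2 = 0\<close> says
  \<open>(u - \<sigma> u) (w - \<sigma> w) = 0\<close> for all \<open>u\<close>, \<open>w\<close> in \<open>k\<^sup>n\<close>, and for fixed \<open>u\<close> and \<open>w\<close> this is a system
  of polynomial equations in the structure constants. Commutativity of \<open>A\<^sub>0\<close> is expressed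
  in the same way.
\<close>

text \<open>Agreement with the polynomial is required at every \<open>x\<close>, also outside
  \<open>extensional I\<close>, so that the closure properties carry no side condition on the
  domain.\<close>

definition polynomial_map :: "'i set \<Rightarrow> (('i \<Rightarrow> 'k::comm_semiring_1) \<Rightarrow> 'k) \<Rightarrow> bool" where
  "polynomial_map I f \<longleftrightarrow> (\<exists>p\<in>mpolys_in I. \<forall>x. f x = mpoly_eval x p)"

lemma polynomial_map_const: "polynomial_map I (\<lambda>x. c)"
  unfolding polynomial_map_def
  by (rule bexI[of _ "Poly_Mapping.single 0 c"])
    (auto simp: mpolys_in_def monom_eval_def split: if_splits)

lemma polynomial_map_var: "i \<in> I \<Longrightarrow> polynomial_map I (\<lambda>x. x i)"
  unfolding polynomial_map_def
  by (rule bexI[of _ "Poly_Mapping.single (Poly_Mapping.single i 1) 1"])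
    (auto simp: mpolys_in_def monom_eval_def split: if_splits)

lemma polynomial_map_add:
  assumes "polynomial_map I f" "polynomial_map I g"
  shows "polynomial_map I (\<lambda>x. f x + g x)"
proof -
  obtain p q where pq: "p \<in> mpolys_in I" "q \<in> mpolys_in I"
    "\<And>x. f x = mpoly_eval x p" "\<And>x. g x = mpoly_eval x q"
    using assms unfolding polynomial_map_def by blast
  then have "p + q \<in> mpolys_in I"
    using Poly_Mapping.keys_add[of p q] unfolding mpolys_in_def by blast
  then show ?thesis
    unfolding polynomial_map_def using pq by (auto intro!: bexI[of _ "p + q"] simp: mpoly_eval_add)
qed

lemma polynomial_map_mult:
  assumes "polynomial_map I f" "polynomial_map I g"
  shows "polynomial_map I (\<lambda>x. f x * g x)"
proof -
  obtain p q where pq: "p \<in> mpolys_in I" "q \<in> mpolys_in I"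
    "\<And>x. f x = mpoly_eval x p" "\<And>x. g x = mpoly_eval x q"
    using assms unfolding polynomial_map_def by blast
  then show ?thesis
    unfolding polynomial_map_def
    by (auto intro!: bexI[of _ "p * q"] mult_in_mpolys_in simp: mpoly_eval_mult)
qed

lemma polynomial_map_diff:
  fixes f g :: "('i \<Rightarrow> 'k::comm_ring_1) \<Rightarrow> 'k"
  assumes "polynomial_map I f" "polynomial_map I g"
  shows "polynomial_map I (\<lambda>x. f x - g x)"
  using polynomial_map_add[OF assms(1) polynomial_map_mult[OF polynomial_map_const[of I "- 1"] assms(2)]]
  by simp

lemma polynomial_map_sum:
  assumes "\<And>a. a \<in> A \<Longrightarrow> polynomial_map I (f a)"
  shows "polynomial_map I (\<lambda>x. \<Sum>a\<in>A. f a x)"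
  using assms
  by (induction A rule: infinite_finite_induct)
    (auto intro: polynomial_map_const polynomial_map_add)

text \<open>One polynomial is chosen for each \<open>a\<close>. The index set \<open>A\<close> may
  be infinite because \<open>algebraic_set\<close> allows arbitrary families; later there is one
  equation for each pair of vectors and each coordinate.\<close>

lemma algebraic_set_zeros:
  fixes f :: "'a \<Rightarrow> ('i \<Rightarrow> 'k::field) \<Rightarrow> 'k"
  assumes "\<And>a. a \<in> A \<Longrightarrow> polynomial_map I (f a)"
  shows "algebraic_set I {x \<in> extensional I. \<forall>a\<in>A. f a x = 0}"
proof -
  obtain p where p: "\<And>a. a \<in> A \<Longrightarrow> p a \<in> mpolys_in I \<and> (\<forall>x. f a x = mpoly_eval x (p a))"
    using assms unfolding polynomial_map_def by metis
  then have "{x \<in> extensional I. \<forall>a\<in>A. f a x = 0} = zero_locus I (p ` A)"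
    by (auto simp: zero_locus_def)
  then show ?thesis
    unfolding algebraic_set_def using p by blast
qed

lemma closedin_Salg_zeros:
  fixes f :: "'a \<Rightarrow> (coord \<Rightarrow> 'k::field) \<Rightarrow> 'k"
  assumes "\<And>a. a \<in> A \<Longrightarrow> polynomial_map (coords n) (f a)"
  shows "closedin (Salg_topology n) {x \<in> Salg n. \<forall>a\<in>A. f a x = 0}"
proof -
  let ?C = "{x \<in> extensional (coords n). \<forall>a\<in>A. f a x = 0}"
  have "{x \<in> Salg n. \<forall>a\<in>A. f a x = 0} = ?C \<inter> Salg n"
    by (auto simp: Salg_def)
  moreover have "closedin (zariski_topology (coords n)) ?C"
    unfolding closedin_zariski using assms by (rule algebraic_set_zeros)
  ultimately show ?thesis
    unfolding Salg_topology_def closedin_subtopology by blast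
qed

lemma sum_fun_apply: "(\<Sum>a\<in>A. f a) y = (\<Sum>a\<in>A. f a y)"
  by (induction A rule: infinite_finite_induct) auto

lemma alg_mult_apply:
  "alg_mult n x v w k =
    (\<Sum>i\<in>{1..n}. \<Sum>j\<in>{1..n}. \<Sum>h\<in>{1..n}. v i * w j * x (Alpha i j h) * basis_vec h k)"
  by (simp add: alg_mult_def sum_fun_apply kscale_def)

lemma alg_sigma_apply:
  "alg_sigma n x v k = (\<Sum>i\<in>{1..n}. \<Sum>j\<in>{1..n}. v i * x (Gamma i j) * basis_vec j k)"
  by (simp add: alg_sigma_def sum_fun_apply kscale_def)

text \<open>The factors may depend on \<open>x\<close> as well, because they will be vectors built
  with \<sigma>, whose matrix entries are themselves coordinates of \<open>x\<close>.\<close>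

lemma polynomial_map_alg_mult:
  fixes v w :: "(coord \<Rightarrow> 'k::field) \<Rightarrow> nat \<Rightarrow> 'k"
  assumes "\<And>i. polynomial_map (coords n) (\<lambda>x. v x i)"
    and "\<And>i. polynomial_map (coords n) (\<lambda>x. w x i)"
  shows "polynomial_map (coords n) (\<lambda>x. alg_mult n x (v x) (w x) k)"
  unfolding alg_mult_apply
  by (intro polynomial_map_sum polynomial_map_mult polynomial_map_var polynomial_map_const assms)
    (auto simp: coords_def)

lemma polynomial_map_alg_sigma:
  fixes v :: "(coord \<Rightarrow> 'k::field) \<Rightarrow> nat \<Rightarrow> 'k"
  assumes "\<And>i. polynomial_map (coords n) (\<lambda>x. v x i)"
  shows "polynomial_map (coords n) (\<lambda>x. alg_sigma n x (v x) k)"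
  unfolding alg_sigma_apply
  by (intro polynomial_map_sum polynomial_map_mult polynomial_map_var polynomial_map_const assms)
    (auto simp: coords_def)

lemma alg_sigma_add: "alg_sigma n x (v + w) = alg_sigma n x v + alg_sigma n x w"
  by (simp add: fun_eq_iff alg_sigma_apply algebra_simps sum.distrib)

lemma alg_sigma_kscale: "alg_sigma n x (kscale c v) = kscale c (alg_sigma n x v)"
  by (simp add: fun_eq_iff alg_sigma_apply kscale_def sum_distrib_left mult.assoc)

lemma alg_sigma_in_kspace: "alg_sigma n x v \<in> kspace n"
  by (auto simp: kspace_def alg_sigma_apply basis_vec_apply intro!: sum.neutral)

lemma kscale_in_kspace: "v \<in> kspace n \<Longrightarrow> kscale c v \<in> kspace n"
  by (simp add: kspace_def kscale_def)

lemma add_in_kspace: "v \<in> kspace n \<Longrightarrow> w \<in> kspace n \<Longrightarrow> v + w \<in> kspace n"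
  by (simp add: kspace_def)

text \<open>When \<open>s * s = 1\<close>, the map \<open>u + s \<sigma> u\<close> is twice the
  projection onto the eigenspace of \<sigma> for \<open>s\<close>. Treating a general
  \<open>s\<close> covers the even part (\<open>s = 1\<close>) and the odd part
  (\<open>s = - 1\<close>) at once.\<close>

lemma sigma_eigenspace_eq_image:
  fixes x :: "coord \<Rightarrow> 'k::field"
  assumes x: "x \<in> Salg n" and two: "(2::'k) \<noteq> 0" and s: "s * s = 1"
  shows "{v \<in> kspace n. alg_sigma n x v = kscale s v} =
    (\<lambda>u. u + kscale s (alg_sigma n x u)) ` kspace n" (is "?E = ?P ` _")
proof (intro subset_antisym subsetI)
  fix v assume v: "v \<in> ?E"
  \<comment> \<open>The preimage of \<open>v\<close> is \<open>v / 2\<close>; here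
    \<open>\<sigma> v\<close> is already replaced by \<open>s v\<close>, and
    \<open>s * s = 1\<close> makes the two halves add up to \<open>v\<close>.\<close>
  have "kscale (1 / 2) v + kscale s (kscale (1 / 2) (kscale s v)) = v"
  proof
    fix i
    have "v i / 2 + s * (s * v i / 2) = (1 + s * s) * v i / 2"
      by (simp add: add_divide_distrib algebra_simps)
    then show "(kscale (1 / 2) v + kscale s (kscale (1 / 2) (kscale s v))) i = v i"
      using s two by (simp add: kscale_def)
  qed
  then have "v = ?P (kscale (1 / 2) v)"
    using v by (simp add: alg_sigma_kscale)
  then show "v \<in> ?P ` kspace n"
    using v kscale_in_kspace by blast
next
  fix v assume "v \<in> ?P ` kspace n"
  then obtain u where u: "u \<in> kspace n" "v = ?P u"
    by blast
  have "alg_sigma n x (alg_sigma n x u) = u"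
    using x u(1) by (simp add: Salg_def)
  \<comment> \<open>Since \<sigma> is an involution it exchanges \<open>u\<close> and
    \<open>\<sigma> u\<close>; factoring out \<open>s\<close> then uses
    \<open>s * s = 1\<close>.\<close>
  then have "alg_sigma n x v = alg_sigma n x u + kscale s u"
    using u(2) by (simp add: alg_sigma_add alg_sigma_kscale)
  also have "\<dots> = kscale s v"
    using s by (simp add: u(2) fun_eq_iff kscale_def distrib_left mult.assoc[symmetric])
  finally show "v \<in> ?E"
    using u by (simp add: add_in_kspace kscale_in_kspace alg_sigma_in_kspace)
qed

text \<open>The trivial factor \<open>kscale 1\<close> is kept so that both parts are images of the
  same family of maps.\<close>

lemma even_part_eq_image:
  fixes x :: "coord \<Rightarrow> 'k::field"
  assumes "x \<in> Salg n" "(2::'k) \<noteq> 0"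
  shows "even_part n x = (\<lambda>u. u + kscale 1 (alg_sigma n x u)) ` kspace n"
  using sigma_eigenspace_eq_image[OF assms, of 1] by (simp add: even_part_def kscale_def)

lemma odd_part_eq_image:
  fixes x :: "coord \<Rightarrow> 'k::field"
  assumes "x \<in> Salg n" "(2::'k) \<noteq> 0"
  shows "odd_part n x = (\<lambda>u. u + kscale (- 1) (alg_sigma n x u)) ` kspace n"
  using sigma_eigenspace_eq_image[OF assms, of "- 1"]
  by (simp add: odd_part_def kscale_def fun_Compl_def)

text \<open>The even and odd parts vary with \<open>x\<close>, but the space \<open>kspace n\<close>
  parametrising them does not. With \<open>u\<close> fixed, \<open>x\<close> enters only through the
  entries of \<sigma>.\<close>

lemma polynomial_map_eigenprojection:
  "polynomial_map (coords n) (\<lambda>x :: coord \<Rightarrow> 'k::field. (u + kscale s (alg_sigma n x u)) i)"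
  unfolding plus_fun_apply kscale_def
  by (intro polynomial_map_add polynomial_map_mult polynomial_map_const polynomial_map_alg_sigma)

lemma two_neq_zero_if_CHAR_neq_2:
  assumes "CHAR('k::field) \<noteq> 2"
  shows "(2::'k) \<noteq> 0"
proof
  assume "(2::'k) = 0"
  then have "CHAR('k) dvd 2"
    using of_nat_eq_0_iff_char_dvd[where 'a = 'k, of 2] by simp
  then have "CHAR('k) = 1 \<or> CHAR('k) = 2"
    using two_is_prime_nat prime_nat_iff by blast
  then show False
    using assms CHAR_not_1[where 'a = 'k] by simp
qed

theorem lemma4p10:
  fixes n :: nat
  assumes char: "CHAR('k::alg_closed_field) \<noteq> 2"
    and n: "n \<ge> 1"
    and closed: "\<And>i. i \<in> {1..n} \<Longrightarrow>
      closedin (Salg_topology n) (Salg_dim n i :: (coord \<Rightarrow> 'k) set)"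
  shows "closedin (Salg_topology n)
           {x \<in> (Salg n :: (coord \<Rightarrow> 'k) set).
              \<forall>v\<in>odd_part n x. \<forall>w\<in>odd_part n x. alg_mult n x v w = 0}
       \<and> closedin (Salg_topology n)
           {x \<in> (Salg n :: (coord \<Rightarrow> 'k) set).
              \<forall>v\<in>even_part n x. \<forall>w\<in>even_part n x. alg_mult n x v w = alg_mult n x w v}"
proof
  note two = two_neq_zero_if_CHAR_neq_2[OF char]
  let ?P = "\<lambda>s (x :: coord \<Rightarrow> 'k) u. u + kscale s (alg_sigma n x u)"
  \<comment> \<open>The last component is the coordinate at which vectors are compared. Coordinates
    outside \<open>{1..n}\<close> only add trivial equations, as products vanish there.\<close>
  let ?I = "kspace n \<times> kspace n \<times> (UNIV :: nat set)"
  have "closedin (Salg_topology n)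
      {x \<in> Salg n. \<forall>(u, w, h)\<in>?I. alg_mult n x (?P (- 1) x u) (?P (- 1) x w) h = 0}"
    unfolding case_prod_unfold
    by (intro closedin_Salg_zeros polynomial_map_alg_mult polynomial_map_eigenprojection)
  also have "{x \<in> Salg n. \<forall>(u, w, h)\<in>?I. alg_mult n x (?P (- 1) x u) (?P (- 1) x w) h = 0} =
      {x \<in> Salg n. \<forall>v\<in>odd_part n x. \<forall>w\<in>odd_part n x. alg_mult n x v w = 0}"
    \<comment> \<open>\<open>conj_cong\<close> supplies \<open>x \<in> Salg n\<close>, under which
      the odd part may be rewritten as an image.\<close>
    by (intro Collect_cong conj_cong refl)
      (simp add: odd_part_eq_image[OF _ two] fun_eq_iff[of "alg_mult _ _ _ _"])
  finally show "closedin (Salg_topology n)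
      {x \<in> (Salg n :: (coord \<Rightarrow> 'k) set).
         \<forall>v\<in>odd_part n x. \<forall>w\<in>odd_part n x. alg_mult n x v w = 0}" .
  \<comment> \<open>Commutativity is posed as the vanishing of all coordinates of commutators of
    even vectors.\<close>
  have "closedin (Salg_topology n)
      {x \<in> Salg n. \<forall>(u, w, h)\<in>?I.
        alg_mult n x (?P 1 x u) (?P 1 x w) h - alg_mult n x (?P 1 x w) (?P 1 x u) h = 0}"
    unfolding case_prod_unfold
    by (intro closedin_Salg_zeros polynomial_map_diff polynomial_map_alg_mult
        polynomial_map_eigenprojection)
  also have "{x \<in> Salg n. \<forall>(u, w, h)\<in>?I.
        alg_mult n x (?P 1 x u) (?P 1 x w) h - alg_mult n x (?P 1 x w) (?P 1 x u) h = 0} =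
      {x \<in> Salg n. \<forall>v\<in>even_part n x. \<forall>w\<in>even_part n x. alg_mult n x v w = alg_mult n x w v}"
    by (intro Collect_cong conj_cong refl)
      (simp add: even_part_eq_image[OF _ two] fun_eq_iff[of "alg_mult _ _ _ _"])
  finally show "closedin (Salg_topology n)
      {x \<in> (Salg n :: (coord \<Rightarrow> 'k) set).
         \<forall>v\<in>even_part n x. \<forall>w\<in>even_part n x. alg_mult n x v w = alg_mult n x w v}" .
qed

end
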